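(* $\mathcal{L}(\mathcal{S})\equiv\mathcal{L}(\mathcal{F})$, where $\mathcal{S}$ is the since operator and $\mathcal{F}$ is the flip-flop operator.
   Context: Write $\mathbb{B}=\{0,1\}$. Static formulas are built from propositional variables and $\top,\bot$ using $\neg,\land,\lor$. An operator automaton is $\mathcal{A}=\langle \mathbb{B}^m,[1,n],\delta,q_{\mathrm{init}}\rangle$ with $\delta:[1,n]\times\mathbb{B}^m\to[1,n]$, $q_{\mathrm{init}}\in[1,n]$. Rules: static $p \;{:}{-}\; \alpha$; delay $p \;{:}{-}\; \ominus q$; dynamic $p_1,\dots,p_n \;{:}{-}\; \mathcal{A}(a_1,\dots,a_m)$. A program is a finite set of rules that is nonrecursive (the graph with an edge $a\to b$ whenever $a$ occurs in the body and $b$ in the head of a rule is acyclic) and definitorial (each variable is in at most one head). Non-defined variables are input variables; an interpretation is a finite non-empty sequence $I=I_1,\dots,I_\ell$ of subsets of input variables. Satisfaction $(P,I,t)\models\cdot$: $\top$ holds, $\bot$ not; input $a$ holds iff $a\in I_t$; Boolean connectives as usual; $p$ defined by $p\;{:}{-}\;\alpha$ iff $(P,I,t)\models\alpha$; $p$ defined by $p\;{:}{-}\;\ominus q$ iff $(P,I,t-1)\models q$; for $p_i$ defined by a dynamic rule, $(P,I,0)\models p_i$ iff $q_{\mathrm{init}}=i$, and for $t>0$, $(P,I,t)\models p_i$ iff there are $j$ and $\sigma\in\mathbb{B}^m$ (an assignment to $a_1,\dots,a_m$, identified with the conjunction of literals it makes true) with $\delta(j,\sigma)=i$, $(P,I,t-1)\models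 p_j$, $(P,I,t)\models\sigma$. $\mathcal{L}(\mathbf{A})$ is the set of programs with static rules, delay rules and dynamic rules with operators from $\mathbf{A}$. A program with ordered input variables and a designated variable $a$ recognises the language of strings $\sigma_1\dots\sigma_\ell$ over $\mathbb{B}^m$ (letters read as assignments to the input variables) with $(P,I,\ell)\models a$; the expressivity of a logic is the set of languages its programs recognise; $\mathcal{L}_1\equiv\mathcal{L}_2$ means the two expressivities coincide. The since operator is $\mathcal{S}=\langle\mathbb{B}^2,\{1,2\},\delta,1\rangle$ with $\delta(q,10)=q$, $\delta(q,01)=\delta(q,11)=2$, $\delta(q,00)=1$. The flip-flop operator is $\mathcal{F}=\langle\mathbb{B}^2,\{1,2\},\delta,1\rangle$ with $\delta(q,00)=q$, $\delta(q,10)=\delta(q,11)=2$, $\delta(q,01)=1$. *)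

theory Defs
  imports Main
begin

type_synonym var = nat

datatype static_formula =
    Top
  | Bot
  | Var var
  | Neg static_formula
  | And static_formula static_formula
  | Or static_formula static_formula

fun fvars :: "static_formula \<Rightarrow> var set" where
  "fvars Top = {}"
| "fvars Bot = {}"
| "fvars (Var p) = {p}"
| "fvars (Neg \<phi>) = fvars \<phi>"
| "fvars (And \<phi> \<psi>) = fvars \<phi> \<union> fvars \<psi>"
| "fvars (Or \<phi> \<psi>) = fvars \<phi> \<union> fvars \<psi>"

text \<open>Elements of $\{0,1\}^m$ are Boolean lists of length $m$ (\<open>True\<close> is $1$). The values of
  \<open>delta\<close> matter only for states in $[1,n]$ and lists of length $m$.\<close>

record automaton =
  arity :: nat
  states :: nat
  delta :: "nat \<Rightarrow> bool list \<Rightarrow> nat"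
  initial :: nat

definition operator_automaton :: "automaton \<Rightarrow> bool" where
  "operator_automaton A \<longleftrightarrow>
     initial A \<in> {1..states A} \<and>
     (\<forall>q\<in>{1..states A}. \<forall>\<sigma>. length \<sigma> = arity A \<longrightarrow> delta A q \<sigma> \<in> {1..states A})"

datatype rule =
    Static var static_formula
  | Delay var var
  | Dynamic "var list" automaton "var list"

fun head :: "rule \<Rightarrow> var set" where
  "head (Static p \<alpha>) = {p}"
| "head (Delay p q) = {p}"
| "head (Dynamic ps A xs) = set ps"

fun body :: "rule \<Rightarrow> var set" where
  "body (Static p \<alpha>) = fvars \<alpha>"
| "body (Delay p q) = {q}"
| "body (Dynamic ps A xs) = set xs"

text \<open>The head variables of a dynamic rule are pairwise distinct, since the truth value of the
  $i$-th one is determined by $i$. The arguments may repeat.\<close>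

fun well_formed_rule :: "rule \<Rightarrow> bool" where
  "well_formed_rule (Static p \<alpha>) = True"
| "well_formed_rule (Delay p q) = True"
| "well_formed_rule (Dynamic ps A xs) \<longleftrightarrow>
     operator_automaton A \<and> length ps = states A \<and> distinct ps \<and> length xs = arity A"

definition dependency :: "rule set \<Rightarrow> (var \<times> var) set" where
  "dependency P = {(a, b). \<exists>r\<in>P. a \<in> body r \<and> b \<in> head r}"

definition nonrecursive :: "rule set \<Rightarrow> bool" where
  "nonrecursive P \<longleftrightarrow> acyclic (dependency P)"

definition definitorial :: "rule set \<Rightarrow> bool" where
  "definitorial P \<longleftrightarrow> (\<forall>r\<in>P. \<forall>r'\<in>P. head r \<inter> head r' \<noteq> {} \<longrightarrow> r = r')"

definition program :: "rule set \<Rightarrow> bool" where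
  "program P \<longleftrightarrow>
     finite P \<and> (\<forall>r\<in>P. well_formed_rule r) \<and> nonrecursive P \<and> definitorial P"

definition vars :: "rule set \<Rightarrow> var set" where
  "vars P = (\<Union>r\<in>P. head r \<union> body r)"

definition defined_vars :: "rule set \<Rightarrow> var set" where
  "defined_vars P = (\<Union>r\<in>P. head r)"

definition input_vars :: "rule set \<Rightarrow> var set" where
  "input_vars P = vars P - defined_vars P"

definition defining_rule :: "rule set \<Rightarrow> var \<Rightarrow> rule" where
  "defining_rule P p = (THE r. r \<in> P \<and> p \<in> head r)"

type_synonym interp = "var set list"

text \<open>Time points are integers, so that the clause for delay rules needs no exception at the
  start. No input variable holds outside of the time points $1,\dots,\ell$.\<close>

definition inputs_at :: "interp \<Rightarrow> int \<Rightarrow> var set" where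
  "inputs_at I t = (if 1 \<le> t \<and> t \<le> int (length I) then I ! nat (t - 1) else {})"

definition assignment_formula :: "var list \<Rightarrow> bool list \<Rightarrow> static_formula" where
  "assignment_formula xs \<sigma> =
     foldr And (map (\<lambda>(a, b). if b then Var a else Neg (Var a)) (zip xs \<sigma>)) Top"

lemma fvars_assignment_formula: "fvars (assignment_formula xs \<sigma>) \<subseteq> set xs"
proof (induction xs arbitrary: \<sigma>)
  case Nil
  then show ?case by (simp add: assignment_formula_def)
next
  case (Cons x xs)
  then show ?case
    by (cases \<sigma>) (auto simp: assignment_formula_def)
qed

text \<open>The variables that a formula depends on, directly or indirectly; their number decreases
  when a defined variable is replaced by the body of its rule.\<close>

definition support :: "rule set \<Rightarrow> var set \<Rightarrow> var set" where
  "support P V = {q. \<exists>v\<in>V. (q, v) \<in> (dependency P)\<^sup>*}"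

lemma finite_fvars: "finite (fvars \<phi>)"
  by (induction \<phi>) auto

lemma finite_head: "finite (head r)"
  by (cases r) auto

lemma finite_body: "finite (body r)"
  by (cases r) (auto simp: finite_fvars)

lemma finite_dependency: "finite P \<Longrightarrow> finite (dependency P)"
proof -
  assume "finite P"
  moreover have "dependency P = (\<Union>r\<in>P. body r \<times> head r)"
    by (auto simp: dependency_def)
  ultimately show ?thesis
    by (simp add: finite_head finite_body)
qed

lemma support_eq: "support P V = V \<union> {q. \<exists>v\<in>V. (q, v) \<in> (dependency P)\<^sup>+}"
  by (auto simp: support_def rtrancl_eq_or_trancl)

lemma finite_support:
  assumes "finite P" "finite V"
  shows "finite (support P V)"
proof -
  have "support P V \<subseteq> V \<union> Domain ((dependency P)\<^sup>+)"
    unfolding support_eq by blast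
  moreover have "finite (V \<union> Domain ((dependency P)\<^sup>+))"
    using assms finite_dependency[of P]
    by (simp add: finite_Domain)
  ultimately show ?thesis by (rule finite_subset)
qed

lemma card_support_mono:
  "finite P \<Longrightarrow> finite W \<Longrightarrow> V \<subseteq> W \<Longrightarrow> card (support P V) \<le> card (support P W)"
  by (rule card_mono) (auto simp: finite_support, auto simp: support_def)

lemma defining_rule:
  assumes "program P" "p \<in> defined_vars P"
  shows "defining_rule P p \<in> P" "p \<in> head (defining_rule P p)"
proof -
  obtain r where r: "r \<in> P" "p \<in> head r"
    using assms by (auto simp: defined_vars_def)
  have "defining_rule P p = r"
    unfolding defining_rule_def
    using r assms by (intro the_equality) (auto simp: program_def definitorial_def)
  then show "defining_rule P p \<in> P" "p \<in> head (defining_rule P p)"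
    using r by auto
qed

lemma card_support_body:
  assumes P: "program P" "p \<in> defined_vars P" and V: "V \<subseteq> body (defining_rule P p)"
  shows "card (support P V) < card (support P {p})"
proof (rule psubset_card_mono)
  show "finite (support P {p})"
    using P by (simp add: finite_support program_def)
  have edge: "(v, p) \<in> dependency P" if "v \<in> V" for v
    using defining_rule[OF P] V that by (auto simp: dependency_def)
  have "q \<in> support P {p}" if "q \<in> support P V" for q
    using that edge by (force simp: support_def)
  moreover have "p \<notin> support P V"
  proof
    assume "p \<in> support P V"
    then have "(p, p) \<in> (dependency P)\<^sup>+"
      using edge by (force simp: support_def intro: rtrancl_into_trancl1)
    then show False
      using P by (auto simp: program_def nonrecursive_def acyclic_def)
  qed
  moreover have "p \<in> support P {p}"
    by (simp add: support_def)
  ultimately show "support P V \<subset> support P {p}"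
    by blast
qed

lemma card_support_head:
  assumes P: "program P" and r: "r \<in> P" "p \<in> head r" "p' \<in> head r"
  shows "card (support P {p'}) = card (support P {p})"
proof -
  have *: "card (support P {x}) = Suc (card {q. \<exists>v\<in>body r. (q, v) \<in> (dependency P)\<^sup>*})"
    if x: "x \<in> head r" for x
  proof -
    have step: "(v, x) \<in> dependency P \<longleftrightarrow> v \<in> body r" for v
      using P r(1) x by (auto simp: dependency_def program_def definitorial_def)
    have eq: "{q. \<exists>v\<in>{x}. (q, v) \<in> (dependency P)\<^sup>+} = {q. \<exists>v\<in>body r. (q, v) \<in> (dependency P)\<^sup>*}"
      using step by (blast dest: tranclD2 intro: rtrancl_into_trancl1)
    have "x \<notin> {q. \<exists>v\<in>{x}. (q, v) \<in> (dependency P)\<^sup>+}"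
      using P by (auto simp: program_def nonrecursive_def acyclic_def)
    moreover have "finite (support P {x})"
      using P by (simp add: finite_support program_def)
    ultimately show ?thesis
      unfolding support_eq eq by simp
  qed
  show ?thesis
    using *[OF r(2)] *[OF r(3)] by simp
qed

text \<open>\<open>sat P I t \<phi>\<close> is $(P,I,t)\models\varphi$. The condition \<open>program P\<close> only makes the recursion
  terminate; \<open>sat\<close> is meant for programs.\<close>

function sat :: "rule set \<Rightarrow> interp \<Rightarrow> int \<Rightarrow> static_formula \<Rightarrow> bool" where
  "sat P I t Top \<longleftrightarrow> True"
| "sat P I t Bot \<longleftrightarrow> False"
| "sat P I t (Neg \<phi>) \<longleftrightarrow> \<not> sat P I t \<phi>"
| "sat P I t (And \<phi> \<psi>) \<longleftrightarrow> sat P I t \<phi> \<and> sat P I t \<psi>"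
| "sat P I t (Or \<phi> \<psi>) \<longleftrightarrow> sat P I t \<phi> \<or> sat P I t \<psi>"
| "sat P I t (Var p) \<longleftrightarrow>
     (if \<not> program P then False
      else if p \<notin> defined_vars P then p \<in> inputs_at I t
      else (case defining_rule P p of
          Static _ \<alpha> \<Rightarrow> sat P I t \<alpha>
        | Delay _ q \<Rightarrow> sat P I (t - 1) (Var q)
        | Dynamic ps A xs \<Rightarrow>
            (\<exists>i\<in>{1..states A}. p = ps ! (i - 1) \<and>
               (if t = 0 then initial A = i
                else if t > 0 then
                  (\<exists>j\<in>{1..states A}. \<exists>\<sigma>\<in>{\<sigma>. length \<sigma> = arity A}.
                     delta A j \<sigma> = i \<and>
                     sat P I (t - 1) (Var (ps ! (j - 1))) \<and>
                     sat P I t (assignment_formula xs \<sigma>))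
                else False))))"
  by pat_completeness auto

termination
proof (relation "measures [\<lambda>(P, I, t, \<phi>). if program P then card (support P (fvars \<phi>)) else 0,
    \<lambda>(P, I, t, \<phi>). nat t, \<lambda>(P, I, t, \<phi>). size \<phi>]", goal_cases)
  case 1
  show ?case by simp
next
  case (7 P I t p q \<alpha>)
  then show ?case
    using card_support_body[of P p "fvars \<alpha>"] by simp
next
  case (8 P I t p q' q)
  then show ?case
    using card_support_body[of P p "{q}"] by simp
next
  case (9 P I t p ps A xs i j)
  then have p: "program P" "p \<in> defined_vars P" "t > 0" "j \<in> {1..states A}"
    and r: "defining_rule P p = Dynamic ps A xs"
    by auto
  have "Dynamic ps A xs \<in> P" "p \<in> set ps"
    using defining_rule[OF p(1,2)] r by auto
  moreover have "ps ! (j - 1) \<in> set ps"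
    using p \<open>Dynamic ps A xs \<in> P\<close> by (force simp: program_def)
  ultimately show ?case
    using p card_support_head[of P "Dynamic ps A xs" p "ps ! (j - 1)"] by simp
next
  case (10 P I t p ps A xs i j \<sigma>)
  then show ?case
    using card_support_body[of P p "fvars (assignment_formula xs \<sigma>)"]
      fvars_assignment_formula[of xs \<sigma>] by simp
next
  case (2 P I t \<phi>)
  then show ?case by simp
next
  case (3 P I t \<phi> \<psi>)
  then show ?case
    using card_support_mono[of P "fvars \<phi> \<union> fvars \<psi>" "fvars \<phi>"]
    by (auto simp: program_def finite_fvars)
next
  case (4 P I t \<phi> \<psi>)
  then show ?case
    using card_support_mono[of P "fvars \<phi> \<union> fvars \<psi>" "fvars \<psi>"]
    by (auto simp: program_def finite_fvars)
next
  case (5 P I t \<phi> \<psi>)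
  then show ?case
    using card_support_mono[of P "fvars \<phi> \<union> fvars \<psi>" "fvars \<phi>"]
    by (auto simp: program_def finite_fvars)
next
  case (6 P I t \<phi> \<psi>)
  then show ?case
    using card_support_mono[of P "fvars \<phi> \<union> fvars \<psi>" "fvars \<psi>"]
    by (auto simp: program_def finite_fvars)
qed

definition logic :: "automaton set \<Rightarrow> rule set set" where
  "logic As = {P. program P \<and> (\<forall>ps A xs. Dynamic ps A xs \<in> P \<longrightarrow> A \<in> As)}"

definition interp_of :: "var list \<Rightarrow> bool list list \<Rightarrow> interp" where
  "interp_of xs w = map (\<lambda>\<sigma>. {xs ! k |k. k < length xs \<and> \<sigma> ! k}) w"

definition recognised :: "rule set \<Rightarrow> var list \<Rightarrow> var \<Rightarrow> bool list list set" where
  "recognised P xs a =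
     {w. w \<noteq> [] \<and> (\<forall>\<sigma>\<in>set w. length \<sigma> = length xs) \<and>
         sat P (interp_of xs w) (int (length w)) (Var a)}"

text \<open>The list \<open>xs\<close> is the ordering of the input variables.\<close>

definition expressivity :: "rule set set \<Rightarrow> bool list list set set" where
  "expressivity L =
     {recognised P xs a |P xs a.
        P \<in> L \<and> distinct xs \<and> set xs = input_vars P \<and> a \<in> vars P}"

definition logic_equiv :: "rule set set \<Rightarrow> rule set set \<Rightarrow> bool"  (infix "\<equiv>\<^sub>L" 50) where
  "L\<^sub>1 \<equiv>\<^sub>L L\<^sub>2 \<longleftrightarrow> expressivity L\<^sub>1 = expressivity L\<^sub>2"

fun since_delta :: "nat \<Rightarrow> bool list \<Rightarrow> nat" where
  "since_delta q [True, False] = q"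
| "since_delta q [False, True] = 2"
| "since_delta q [True, True] = 2"
| "since_delta q [False, False] = 1"

definition since :: automaton where
  "since = \<lparr>arity = 2, states = 2, delta = since_delta, initial = 1\<rparr>"

fun flip_flop_delta :: "nat \<Rightarrow> bool list \<Rightarrow> nat" where
  "flip_flop_delta q [False, False] = q"
| "flip_flop_delta q [True, False] = 2"
| "flip_flop_delta q [True, True] = 2"
| "flip_flop_delta q [False, True] = 1"

definition flip_flop :: automaton where
  "flip_flop = \<lparr>arity = 2, states = 2, delta = flip_flop_delta, initial = 1\<rparr>"

lemma bool_list_length_2:
  "length \<sigma> = 2 \<Longrightarrow>
     \<sigma> = [True, False] \<or> \<sigma> = [False, True] \<or> \<sigma> = [True, True] \<or> \<sigma> = [False, False]"
  by (cases \<sigma> rule: list.exhaust; cases "tl \<sigma>") auto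

lemma operator_automaton_since: "operator_automaton since"
  by (auto simp: operator_automaton_def since_def dest!: bool_list_length_2)

lemma operator_automaton_flip_flop: "operator_automaton flip_flop"
  by (auto simp: operator_automaton_def flip_flop_def dest!: bool_list_length_2)

end

(* The since and flip-flop operators are the same automaton up to negating and swapping arguments:
   S(a, b) behaves as F(b, not a) and F(s, r) behaves as S(not r, s). Hence either kind of program
   is turned into the other kind by adding one static rule for the negation of each variable and
   rewiring the arguments of the dynamic rules. *)
theory Submission
  imports Defs
begin

section \<open>Satisfaction, one kind of rule at a time\<close>

lemma sat_cong_vars:
  assumes "\<And>v. v \<in> fvars \<phi> \<Longrightarrow> sat P I t (Var v) = sat Q J s (Var v)"
  shows "sat P I t \<phi> = sat Q J s \<phi>"
  using assms by (induction \<phi>) (simp_all del: sat.simps(6))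

text \<open>The conjunction fixes the truth value of every argument, so exactly one
  \<open>\<sigma>\<close> of the right length makes it true. This removes the quantifier over
  \<open>\<sigma>\<close> from the clause for dynamic rules.\<close>

lemma sat_assignment_formula:
  assumes "length \<sigma> = length xs"
  shows "sat P I t (assignment_formula xs \<sigma>) \<longleftrightarrow> \<sigma> = map (\<lambda>x. sat P I t (Var x)) xs"
  using assms
proof (induction \<sigma> xs rule: list_induct2)
  case Nil
  then show ?case by (simp add: assignment_formula_def)
next
  case (Cons b \<sigma> x xs)
  then show ?case
    by (cases b) (simp_all add: assignment_formula_def del: sat.simps(6))
qed

lemma defining_ruleI:
  assumes "program P" "r \<in> P" "p \<in> head r"
  shows "defining_rule P p = r"
  unfolding defining_rule_def
  using assms by (intro the_equality) (auto simp: program_def definitorial_def)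

lemma defined_varsI: "r \<in> P \<Longrightarrow> p \<in> head r \<Longrightarrow> p \<in> defined_vars P"
  by (auto simp: defined_vars_def)

lemma sat_input:
  assumes "program P" "p \<notin> defined_vars P"
  shows "sat P I t (Var p) \<longleftrightarrow> p \<in> inputs_at I t"
  using assms by simp

lemma sat_static:
  assumes "program P" "Static p \<alpha> \<in> P"
  shows "sat P I t (Var p) \<longleftrightarrow> sat P I t \<alpha>"
  using assms defining_ruleI[OF assms, of p] defined_varsI[OF assms(2), of p] by simp

lemma sat_delay:
  assumes "program P" "Delay p q \<in> P"
  shows "sat P I t (Var p) \<longleftrightarrow> sat P I (t - 1) (Var q)"
  using assms defining_ruleI[OF assms, of p] defined_varsI[OF assms(2), of p]
  by (subst sat.simps(6)) (simp del: sat.simps(6))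

text \<open>Turns the dynamic clause into a plain recurrence over time: distinct heads leave only
  one possible index for the variable, and the current argument values leave only one
  \<open>\<sigma>\<close>. At negative times all heads are false.\<close>

lemma sat_dynamic:
  assumes P: "program P" and r: "Dynamic ps A xs \<in> P" and i: "i \<in> {1..states A}"
  shows "sat P I t (Var (ps ! (i - 1))) \<longleftrightarrow>
    (if t = 0 then initial A = i
     else t > 0 \<and> (\<exists>j\<in>{1..states A}. delta A j (map (\<lambda>x. sat P I t (Var x)) xs) = i \<and>
       sat P I (t - 1) (Var (ps ! (j - 1)))))"
proof -
  have wf: "length ps = states A" "distinct ps" "length xs = arity A"
    using P r by (auto simp: program_def)
  have in_ps: "ps ! (i - 1) \<in> set ps"
    using i wf by (intro nth_mem) auto
  have index: "ps ! (i - 1) = ps ! (k - 1) \<longleftrightarrow> k = i" if "k \<in> {1..states A}" for k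
    using that i wf by (auto simp: nth_eq_iff_index_eq)
  have collapse: "(\<exists>k\<in>{1..states A}. ps ! (i - 1) = ps ! (k - 1) \<and> Q k) \<longleftrightarrow> Q i" for Q
    using index i by blast
  have unique: "(\<exists>\<sigma>\<in>{\<sigma>. length \<sigma> = arity A}. delta A j \<sigma> = i \<and> b \<and>
        sat P I t (assignment_formula xs \<sigma>)) \<longleftrightarrow>
      delta A j (map (\<lambda>x. sat P I t (Var x)) xs) = i \<and> b" for j b
    using wf by (auto simp: sat_assignment_formula simp del: sat.simps(6))
  have "defining_rule P (ps ! (i - 1)) = Dynamic ps A xs" "ps ! (i - 1) \<in> defined_vars P"
    using defining_ruleI[OF P r] defined_varsI[OF r] in_ps by auto
  then have "sat P I t (Var (ps ! (i - 1))) \<longleftrightarrow>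
      (\<exists>k\<in>{1..states A}. ps ! (i - 1) = ps ! (k - 1) \<and>
        (if t = 0 then initial A = k
         else if t > 0 then
           (\<exists>j\<in>{1..states A}. \<exists>\<sigma>\<in>{\<sigma>. length \<sigma> = arity A}. delta A j \<sigma> = k \<and>
              sat P I (t - 1) (Var (ps ! (j - 1))) \<and> sat P I t (assignment_formula xs \<sigma>))
         else False))"
    using P by (subst sat.simps(6)) (simp del: sat.simps(6))
  also have "\<dots> \<longleftrightarrow> (if t = 0 then initial A = i
         else if t > 0 then
           (\<exists>j\<in>{1..states A}. \<exists>\<sigma>\<in>{\<sigma>. length \<sigma> = arity A}. delta A j \<sigma> = i \<and>
              sat P I (t - 1) (Var (ps ! (j - 1))) \<and> sat P I t (assignment_formula xs \<sigma>))
         else False)"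
    by (rule collapse)
  finally show ?thesis
    unfolding unique by simp
qed

section \<open>Ranking variables by the size of their support\<close>

text \<open>Provides a rank that strictly grows along dependencies. It yields acyclicity of the
  rewired program and also drives the induction comparing the two programs.\<close>

lemma card_support_dependency:
  assumes "program P" "(a, b) \<in> dependency P"
  shows "card (support P {a}) < card (support P {b})"
proof -
  obtain r where r: "r \<in> P" "a \<in> body r" "b \<in> head r"
    using assms(2) by (auto simp: dependency_def)
  have "defining_rule P b = r" "b \<in> defined_vars P"
    using defining_ruleI[OF assms(1) r(1,3)] defined_varsI[OF r(1,3)] by auto
  then show ?thesis
    using card_support_body[OF assms(1), of b "{a}"] r(2) by simp
qed

lemma acyclic_if_increasing:
  fixes f :: "'a \<Rightarrow> nat"
  assumes "\<And>a b. (a, b) \<in> R \<Longrightarrow> f a < f b"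
  shows "acyclic R"
proof (rule acyclic_subset)
  show "acyclic (measure f)"
    by (rule wf_acyclic) simp
  show "R \<subseteq> measure f"
    using assms by auto
qed

lemma finite_vars: "finite P \<Longrightarrow> finite (vars P)"
  by (simp add: vars_def finite_head finite_body)

section \<open>Replacing one operator by another\<close>

text \<open>The list \<open>lits\<close> describes how the arguments of \<open>B\<close> are obtained from those of \<open>A\<close>: an entry
  \<open>(b, k)\<close> stands for the \<open>k\<close>-th argument of \<open>A\<close> (counted from \<open>0\<close>), negated if \<open>b\<close> is false.\<close>

locale automaton_wiring =
  fixes A B :: automaton and lits :: "(bool \<times> nat) list"
  assumes operator_B: "operator_automaton B"
    and states_eq: "states B = states A"
    and initial_eq: "initial B = initial A"
    and length_lits: "length lits = arity B"
    and lits_bound: "\<And>b k. (b, k) \<in> set lits \<Longrightarrow> k < arity A"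
    and delta_eq: "\<And>j \<sigma>. length \<sigma> = arity A \<Longrightarrow>
      delta B j (map (\<lambda>(b, k). \<sigma> ! k = b) lits) = delta A j \<sigma>"
begin

text \<open>The variable \<open>x + M\<close> is meant to hold the negation of \<open>x\<close>.\<close>

definition rewire_args :: "nat \<Rightarrow> var list \<Rightarrow> var list" where
  "rewire_args M xs = map (\<lambda>(b, k). if b then xs ! k else xs ! k + M) lits"

text \<open>\<open>A'\<close> is replaced by \<open>B\<close> without inspection; the intended rules
  come from programs in \<open>logic {A}\<close>, where \<open>A' = A\<close>.\<close>

fun rewire_rule :: "nat \<Rightarrow> rule \<Rightarrow> rule" where
  "rewire_rule M (Dynamic ps A' xs) = Dynamic ps B (rewire_args M xs)"
| "rewire_rule M r = r"

text \<open>Negations are supplied for all of \<open>vars P\<close> at once, so every shifted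
  argument is defined, whichever entries \<open>lits\<close> selects.\<close>

definition rewire :: "nat \<Rightarrow> rule set \<Rightarrow> rule set" where
  "rewire M P = rewire_rule M ` P \<union> (\<lambda>v. Static (v + M) (Neg (Var v))) ` vars P"

lemma set_rewire_args:
  assumes "length xs = arity A"
  shows "set (rewire_args M xs) \<subseteq> set xs \<union> (\<lambda>v. v + M) ` set xs"
  using assms lits_bound by (fastforce simp: rewire_args_def)

lemma head_rewire_rule [simp]: "head (rewire_rule M r) = head r"
  by (cases r) auto

lemma body_rewire_rule:
  assumes "well_formed_rule r" "\<And>ps A' xs. r = Dynamic ps A' xs \<Longrightarrow> A' = A"
  shows "body (rewire_rule M r) \<subseteq> body r \<union> (\<lambda>v. v + M) ` body r"
  using assms set_rewire_args by (cases r) auto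

lemma well_formed_rewire_rule:
  assumes "well_formed_rule r" "\<And>ps A' xs. r = Dynamic ps A' xs \<Longrightarrow> A' = A"
  shows "well_formed_rule (rewire_rule M r)"
  using assms operator_B states_eq length_lits by (cases r) (auto simp: rewire_args_def)

lemma defined_vars_rewire:
  "defined_vars (rewire M P) = defined_vars P \<union> (\<lambda>v. v + M) ` vars P"
  by (auto simp: defined_vars_def rewire_def)

section \<open>Admissibility of the rewired program\<close>

context
  fixes P :: "rule set" and M :: nat
  assumes logic_A: "P \<in> logic {A}" and bound: "vars P \<subseteq> {..<M}"
begin

lemma program_A: "program P"
  using logic_A by (simp add: logic_def)

lemma rule_A:
  assumes "r \<in> P"
  shows "well_formed_rule r" "r = Dynamic ps A' xs \<Longrightarrow> A' = A"
    "head r \<subseteq> vars P" "body r \<subseteq> vars P"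
  using assms logic_A by (auto simp: logic_def program_def vars_def)

lemma body_rewire_rule_A:
  assumes "r \<in> P"
  shows "body (rewire_rule M r) \<subseteq> body r \<union> (\<lambda>v. v + M) ` body r"
  using assms rule_A by (intro body_rewire_rule) auto

lemma vars_rewire: "vars (rewire M P) = vars P \<union> (\<lambda>v. v + M) ` vars P"
proof
  show "vars (rewire M P) \<subseteq> vars P \<union> (\<lambda>v. v + M) ` vars P"
  proof
    fix v
    assume "v \<in> vars (rewire M P)"
    then consider r where "r \<in> P" "v \<in> head r \<union> body (rewire_rule M r)"
      \<comment> \<open>This alternative absorbs the negation rules and is already the goal, so only
        the first one is treated below.\<close>
      | "v \<in> vars P \<union> (\<lambda>v. v + M) ` vars P"
      unfolding vars_def[of "rewire M P"] unfolding rewire_def by auto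
    then show "v \<in> vars P \<union> (\<lambda>v. v + M) ` vars P"
    proof cases
      case 1
      then show ?thesis
        using body_rewire_rule_A[of r] rule_A(3,4)[of r] by blast
    qed
  qed
  show "vars P \<union> (\<lambda>v. v + M) ` vars P \<subseteq> vars (rewire M P)"
    unfolding vars_def[of "rewire M P"] unfolding rewire_def by auto
qed

text \<open>Since all of \<open>vars P\<close> lies below \<open>M\<close>, each
  \<open>v + M\<close> is fresh; the fresh variables that occur are heads of negation rules, so none
  becomes an input.\<close>

lemma input_vars_rewire: "input_vars (rewire M P) = input_vars P"
proof -
  have "v + M \<notin> vars P" for v
    using bound by fastforce
  moreover have "defined_vars P \<subseteq> vars P"
    by (auto simp: defined_vars_def vars_def)
  ultimately show ?thesis
    unfolding input_vars_def vars_rewire defined_vars_rewire by blast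
qed

lemma nonrecursive_rewire: "nonrecursive (rewire M P)"
  unfolding nonrecursive_def
proof (rule acyclic_if_increasing)
  let ?s = "\<lambda>v. card (support P {v})"
  \<comment> \<open>Doubling the rank leaves an odd value for \<open>v + M\<close>, strictly between
    that of \<open>v\<close> and that of any variable depending on \<open>v\<close> in
    \<open>P\<close>.\<close>
  let ?f = "\<lambda>v. if v < M then 2 * ?s v else 2 * ?s (v - M) + 1"
  fix a b
  assume "(a, b) \<in> dependency (rewire M P)"
  then consider r where "r \<in> P" "a \<in> body (rewire_rule M r)" "b \<in> head r"
    | "a \<in> vars P" "b = a + M"
    by (auto simp: dependency_def rewire_def)
  then show "?f a < ?f b"
  proof cases
    case 1
    then obtain v where v: "v \<in> body r" "a = v \<or> a = v + M"
      using body_rewire_rule_A[of r] by blast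
    have "v < M" "b < M"
      using v 1 rule_A(3,4)[of r] bound by auto
    moreover have "?s v < ?s b"
      using v 1 by (intro card_support_dependency program_A) (auto simp: dependency_def)
    ultimately show ?thesis
      using v(2) by auto
  next
    case 2
    then show ?thesis
      using bound by auto
  qed
qed

lemma definitorial_rewire: "definitorial (rewire M P)"
proof -
  have original: "rewire_rule M r = rewire_rule M r'"
    if "r \<in> P" "r' \<in> P" "head r \<inter> head r' \<noteq> {}" for r r'
  proof -
    have "r = r'"
      using that program_A unfolding program_def definitorial_def by blast
    then show ?thesis by simp
  qed
  have new: "v + M \<notin> head r" if "r \<in> P" for r v
    using rule_A(3)[OF that] bound by fastforce
  show ?thesis
    unfolding definitorial_def
  proof (intro ballI impI)
    fix s s'
    assume s: "s \<in> rewire M P" "s' \<in> rewire M P" and meet: "head s \<inter> head s' \<noteq> {}"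
    have cases: "(\<exists>r\<in>P. s = rewire_rule M r) \<or> (\<exists>v. s = Static (v + M) (Neg (Var v)))"
      if "s \<in> rewire M P" for s
      using that unfolding rewire_def by blast
    show "s = s'"
      using cases[OF s(1)] cases[OF s(2)]
    proof (elim disjE bexE exE)
      fix r r'
      assume "r \<in> P" "r' \<in> P" "s = rewire_rule M r" "s' = rewire_rule M r'"
      then show ?thesis
        using original[of r r'] meet by simp
    \<comment> \<open>A rewired rule cannot meet a negation rule, by freshness; two negation rules
      that meet shift the same variable.\<close>
    qed (use meet new in auto)
  qed
qed

lemma program_rewire: "program (rewire M P)"
  unfolding program_def
proof (intro conjI ballI)
  show "finite (rewire M P)"
    using program_A by (simp add: rewire_def program_def finite_vars)
  show "well_formed_rule r" if "r \<in> rewire M P" for r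
    using that rule_A by (auto simp: rewire_def intro!: well_formed_rewire_rule)
qed (fact nonrecursive_rewire definitorial_rewire)+

lemma logic_rewire: "rewire M P \<in> logic {B}"
proof -
  have "A' = B" if "rewire_rule M r = Dynamic ps A' xs" for r ps A' xs
    using that by (cases r) auto
  then show ?thesis
    using program_rewire by (auto simp: logic_def rewire_def) metis
qed

lemma rewire_ruleI: "r \<in> P \<Longrightarrow> rewire_rule M r \<in> rewire M P"
  by (simp add: rewire_def)

section \<open>Preservation of truth values\<close>

lemma sat_rewire_negation:
  assumes "v \<in> vars P"
  shows "sat (rewire M P) I t (Var (v + M)) \<longleftrightarrow> \<not> sat (rewire M P) I t (Var v)"
proof -
  have "Static (v + M) (Neg (Var v)) \<in> rewire M P"
    using assms by (simp add: rewire_def)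
  from sat_static[OF program_rewire this] show ?thesis
    by (simp del: sat.simps(6))
qed

text \<open>Outer induction on support size, at all times simultaneously, covers body variables.
  Heads of a dynamic rule refer to each other at the previous time and have equal support, so that
  case needs an inner induction on time.\<close>

lemma sat_rewire:
  assumes "p \<in> vars P"
  shows "sat (rewire M P) I t (Var p) = sat P I t (Var p)"
  using assms
proof (induction "card (support P {p})" arbitrary: p t rule: less_induct)
  case less
  show ?case
  proof (cases "p \<in> defined_vars P")
    case False
    then have "p \<notin> defined_vars (rewire M P)"
      using less.prems bound by (auto simp: defined_vars_rewire)
    with False show ?thesis
      by (simp only: sat_input program_A program_rewire not_False_eq_True)
  next
    case True
    then obtain r where r: "r \<in> P" "p \<in> head r"
      by (auto simp: defined_vars_def)
    have IH: "sat (rewire M P) I s (Var v) = sat P I s (Var v)" if "v \<in> body r" for v s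
    proof (rule less.hyps)
      show "card (support P {v}) < card (support P {p})"
        using that r by (intro card_support_dependency program_A) (auto simp: dependency_def)
      show "v \<in> vars P"
        using that rule_A(4)[OF r(1)] by blast
    qed
    note r' = rewire_ruleI[OF r(1)]
    show ?thesis
    proof (cases r)
      case (Static q \<alpha>)
      with r r' have "Static p \<alpha> \<in> P" "Static p \<alpha> \<in> rewire M P"
        by auto
      then show ?thesis
        using IH Static sat_cong_vars[of \<alpha> "rewire M P" I t P I t]
        by (simp add: sat_static[OF program_A] sat_static[OF program_rewire] del: sat.simps(6))
    next
      case (Delay q' q)
      with r r' have "Delay p q \<in> P" "Delay p q \<in> rewire M P"
        by auto
      then show ?thesis
        using IH Delay
        by (simp add: sat_delay[OF program_A] sat_delay[OF program_rewire] del: sat.simps(6))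
    next
      case (Dynamic ps A' xs)
      then have r_eq: "r = Dynamic ps A xs"
        using rule_A(2)[OF r(1)] by blast
      then have rA: "Dynamic ps A xs \<in> P" and rB: "Dynamic ps B (rewire_args M xs) \<in> rewire M P"
        using r r' by auto
      have xs: "length xs = arity A" "set xs \<subseteq> vars P" and ps: "length ps = states A"
        using rule_A(1,4)[OF r(1)] r_eq by auto
      let ?v = "\<lambda>s x. sat (rewire M P) I s (Var x)"
      \<comment> \<open>Under the wiring, \<open>B\<close> reads from the rewired arguments what
        makes it move exactly as \<open>A\<close> does on the original ones.\<close>
      have args: "delta B j (map (?v s) (rewire_args M xs)) =
          delta A j (map (\<lambda>x. sat P I s (Var x)) xs)" for j s
      proof -
        have "map (?v s) (rewire_args M xs) = map (\<lambda>(b, k). map (?v s) xs ! k = b) lits"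
          unfolding rewire_args_def map_map
        proof (rule map_cong[OF refl], clarify)
          fix b k
          assume "(b, k) \<in> set lits"
          then have "k < length xs"
            using lits_bound xs by simp
          then have "xs ! k \<in> vars P"
            using xs(2) nth_mem by blast
          then show "(?v s \<circ> (\<lambda>(b, k). if b then xs ! k else xs ! k + M)) (b, k) =
              (map (?v s) xs ! k = b)"
            using \<open>k < length xs\<close> sat_rewire_negation[of "xs ! k" I s]
            by (auto simp del: sat.simps(6))
        qed
        also have "map (?v s) xs = map (\<lambda>x. sat P I s (Var x)) xs"
          using IH r_eq by (intro map_cong[OF refl]) (simp del: sat.simps(6))
        finally show ?thesis
          using delta_eq xs by (simp del: sat.simps(6))
      qed
      note stepA = sat_dynamic[OF program_A rA]
        and stepB = sat_dynamic[OF program_rewire rB, unfolded states_eq]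
      \<comment> \<open>All heads are treated together, because the recurrence for one state
        consults every state at the preceding time.\<close>
      have "sat (rewire M P) I (int n) (Var (ps ! (i - 1))) = sat P I (int n) (Var (ps ! (i - 1)))"
        if "i \<in> {1..states A}" for n i
        using that
      proof (induction n arbitrary: i)
        case 0
        then show ?case
          by (simp only: stepA stepB initial_eq of_nat_0 if_True simp_thms)
      next
        case (Suc n)
        have "int (Suc n) - 1 = int n" by simp
        then show ?case
          by (simp only: stepA[OF Suc.prems, of I "int (Suc n)"]
              stepB[OF Suc.prems, of I "int (Suc n)"] args Suc.IH initial_eq cong: bex_cong)
      qed
      moreover have "sat (rewire M P) I s (Var (ps ! (i - 1))) = sat P I s (Var (ps ! (i - 1)))"
        if "s < 0" "i \<in> {1..states A}" for s i
      proof -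
        have "s \<noteq> 0" "\<not> s > 0"
          using that(1) by auto
        then show ?thesis
          by (simp only: stepA stepB that(2) if_False simp_thms)
      qed
      moreover obtain i where "i \<in> {1..states A}" "p = ps ! (i - 1)"
      proof -
        obtain k where "k < length ps" "p = ps ! k"
          using r(2) r_eq by (auto simp: in_set_conv_nth)
        then show ?thesis
          \<comment> \<open>List positions start at \<open>0\<close> and states at \<open>1\<close>,
            hence the witness \<open>Suc k\<close>.\<close>
          using ps by (intro that[of "Suc k"]) auto
      qed
      ultimately show ?thesis
        by (metis not_less zero_le_imp_eq_int)
    qed
  qed
qed

end

text \<open>The rewired program recognises the same language with the same input ordering
  \<open>xs\<close> and the same designated variable \<open>a\<close>, as inputs and truth values on
  \<open>vars P\<close> are unchanged.\<close>

lemma expressivity_subset: "expressivity (logic {A}) \<subseteq> expressivity (logic {B})"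
proof
  fix L
  assume "L \<in> expressivity (logic {A})"
  then obtain P xs a where L: "L = recognised P xs a" and P: "P \<in> logic {A}"
    and xs: "distinct xs" "set xs = input_vars P" and a: "a \<in> vars P"
    by (auto simp: expressivity_def)
  have "finite (vars P)"
    using P by (simp add: logic_def program_def finite_vars)
  then obtain M where "\<forall>v\<in>vars P. v < M"
    unfolding finite_nat_set_iff_bounded ..
  then have M: "vars P \<subseteq> {..<M}" by auto
  have "L = recognised (rewire M P) xs a"
    using sat_rewire[OF P M a] by (simp add: L recognised_def del: sat.simps(6))
  moreover have "set xs = input_vars (rewire M P)" "a \<in> vars (rewire M P)"
    using xs(2) a vars_rewire[OF P M] input_vars_rewire[OF P M] by simp_all
  ultimately show "L \<in> expressivity (logic {B})"
    using logic_rewire[OF P M] xs(1) unfolding expressivity_def mem_Collect_eq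
    by (intro exI conjI)
qed

end

section \<open>The two concrete wirings\<close>

text \<open>In \<open>since\<close> the second argument sets and a false first argument resets;
  setting wins a conflict in both operators, so the four input letters correspond.\<close>

lemma since_to_flip_flop: "automaton_wiring since flip_flop [(True, 1), (False, 0)]"
proof
  fix j and \<sigma> :: "bool list"
  assume "length \<sigma> = arity since"
  then show "delta flip_flop j (map (\<lambda>(b, k). \<sigma> ! k = b) [(True, 1), (False, 0)]) =
      delta since j \<sigma>"
    by (auto simp: since_def flip_flop_def dest!: bool_list_length_2)
qed (use operator_automaton_flip_flop in \<open>auto simp: since_def flip_flop_def\<close>)

lemma flip_flop_to_since: "automaton_wiring flip_flop since [(False, 1), (True, 0)]"
proof
  fix j and \<sigma> :: "bool list"
  assume "length \<sigma> = arity flip_flop"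
  then show "delta since j (map (\<lambda>(b, k). \<sigma> ! k = b) [(False, 1), (True, 0)]) =
      delta flip_flop j \<sigma>"
    by (auto simp: since_def flip_flop_def dest!: bool_list_length_2)
qed (use operator_automaton_since in \<open>auto simp: since_def flip_flop_def\<close>)

theorem theorem10: "logic {since} \<equiv>\<^sub>L logic {flip_flop}"
  unfolding logic_equiv_def
  using automaton_wiring.expressivity_subset[OF since_to_flip_flop]
    automaton_wiring.expressivity_subset[OF flip_flop_to_since]
  by blast

end
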